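(* Let $f:\mathbb{R}^n\to\mathbb{R}$ be a polynomial function of degree $d\geq 1$. Then for any compact semialgebraic subset $A$ of $\mathbb{R}^n$ there exists $C=C(f,A)>0$ such that for every $C^1$ function $g:\mathbb{R}^n\to\mathbb{R}$ with compact support contained in $A$, \[\left|\int_A e^{i\lambda f(x)} g(x)\,dx\right|\leq C\lambda^{-\frac1d}\big(\|g\|_\infty+\|\nabla g\|_1\big)\quad\text{for all }\lambda>0.\]
   Context: For a $C^1$ function $g$ with compact support, $\|g\|_\infty=\sup_{\mathbb{R}^n}|g|$ and $\|\nabla g\|_1=\int_{\mathbb{R}^n}\|\nabla g(x)\|\,dx$, where $\|\cdot\|$ is the Euclidean norm. *)

theory Defs
  imports "HOL-Analysis.Analysis"
begin

text \<open>A real polynomial in the coordinates of real^'n is represented by its coefficient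
  function on exponent vectors (multi-indices) alpha :: 'n => nat, with finite support.\<close>

definition mpoly_coeffs :: "(('n::finite \<Rightarrow> nat) \<Rightarrow> real) \<Rightarrow> bool" where
  "mpoly_coeffs c \<longleftrightarrow> finite {\<alpha>. c \<alpha> \<noteq> 0}"

definition mpoly_eval :: "(('n::finite \<Rightarrow> nat) \<Rightarrow> real) \<Rightarrow> real^'n \<Rightarrow> real" where
  "mpoly_eval c x = (\<Sum>\<alpha>\<in>{\<alpha>. c \<alpha> \<noteq> 0}. c \<alpha> * (\<Prod>i\<in>UNIV. (x $ i) ^ (\<alpha> i)))"

text \<open>Total degree (the zero polynomial gets degree 0).\<close>
definition mpoly_degree :: "(('n::finite \<Rightarrow> nat) \<Rightarrow> real) \<Rightarrow> nat" where
  "mpoly_degree c = Max (insert 0 ((\<lambda>\<alpha>. \<Sum>i\<in>UNIV. \<alpha> i) ` {\<alpha>. c \<alpha> \<noteq> 0}))"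

definition polynomial_function_on :: "(real^'n::finite \<Rightarrow> real) \<Rightarrow> bool" where
  "polynomial_function_on p \<longleftrightarrow> (\<exists>c. mpoly_coeffs c \<and> p = mpoly_eval c)"

inductive semialgebraic :: "(real^'n::finite) set \<Rightarrow> bool" where
  sa_pos: "polynomial_function_on p \<Longrightarrow> semialgebraic {x. p x > 0}"
| sa_zero: "polynomial_function_on p \<Longrightarrow> semialgebraic {x. p x = 0}"
| sa_union: "semialgebraic A \<Longrightarrow> semialgebraic B \<Longrightarrow> semialgebraic (A \<union> B)"
| sa_inter: "semialgebraic A \<Longrightarrow> semialgebraic B \<Longrightarrow> semialgebraic (A \<inter> B)"
| sa_compl: "semialgebraic A \<Longrightarrow> semialgebraic (- A)"

end

(* The leading coefficient of s -> f (x + s v) is top_form c v, independent of x, so choosing a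
   direction v with top_form c v nonzero, van der Corput's lemma bounds the oscillatory integral
   along every segment from x to x + v by a multiple of t^(-1/d), uniformly in x. By translation
   invariance and Fubini, the integral of F over R^n is the integral over x of the integral of
   s -> F (x + s v) over s in [0,1], so no rotation of coordinates is needed; only x in a bounded
   set contribute, which turns the boundary term of the one-dimensional bound into the sup norm. *)

theory Submission
  imports Defs
begin

text \<open>The \<open>d\<close>-th derivative of s -> t f(x + s v) is the constant t d!
  \<open>top_form c v\<close>, so one derivative order and one lower bound serve on every segment,
  whatever \<open>x\<close> is. The amplitude enters by integration by parts against a primitive of
  the oscillating factor; this needs the same bound on all initial subintervals, which is why the
  one-dimensional estimate must not depend on the interval. What remains on each segment is an
  endpoint value of \<open>g\<close> and its variation. The variation is at most
  \<open>norm v\<close> times the integral of the gradient norm along the segment, and averaging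
  over \<open>x\<close> turns it into the L^1 norm of the gradient. The endpoint value is replaced
  by the sup norm, at the price of the volume of a ball of radius \<open>R + norm v\<close>. A
  direction with nonzero top form exists because a real polynomial with a nonzero coefficient does
  not vanish identically, made explicit by the Kronecker substitution.\<close>

section \<open>The van der Corput lemma for polynomial phases\<close>

lemma cis_poly_integrable [simp]:
  "(\<lambda>x. cis (poly p x)) integrable_on {a..b}"
  by (intro integrable_continuous_real continuous_intros)

lemma norm_integral_cis_uminus:
  "norm (integral S (\<lambda>x. cis (- h x))) = norm (integral S (\<lambda>x. cis (h x)))"
proof -
  have "integral S (\<lambda>x. cis (- h x)) = cnj (integral S (\<lambda>x. cis (h x)))"
    by (simp add: integral_cnj cis_cnj)
  then show ?thesis by simp
qed

lemma norm_integral_cis_poly_le_length: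
  assumes "a \<le> b"
  shows "norm (integral {a..b} (\<lambda>x. cis (poly p x))) \<le> b - a"
proof -
  have "continuous_on {a..b} (\<lambda>x. cis (poly p x))" by (intro continuous_intros)
  then show ?thesis using integral_bound[OF assms, of "\<lambda>x. cis (poly p x)" 1] by simp
qed

text \<open>Integration by parts: \<open>cis (poly p x)\<close> is the derivative of
  \<open>G\<close> = cis(p) / (i p') up to the error \<open>E\<close>. The sign
  \<open>\<sigma>\<close> encodes that p'' does not change sign. The 3 counts two endpoint values of
  \<open>G\<close> and one error integral, each at most \<open>1 / \<mu>\<close>.\<close>

lemma van_der_Corput_first_derivative:
  fixes p :: "real poly"
  assumes "a \<le> b" "\<mu> > 0"
    and ge: "\<And>x. x \<in> {a..b} \<Longrightarrow> poly (pderiv p) x \<ge> \<mu>"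
    and \<sigma>: "\<And>x. x \<in> {a..b} \<Longrightarrow> \<bar>poly (pderiv (pderiv p)) x\<bar> = \<sigma> * poly (pderiv (pderiv p)) x"
    and "\<bar>\<sigma>\<bar> = 1"
  shows "norm (integral {a..b} (\<lambda>x. cis (poly p x))) \<le> 3 / \<mu>"
proof -
  define q r where "q = pderiv p" and "r = pderiv q"
  have qpos: "poly q x > 0" "poly q x \<noteq> 0" if "x \<in> {a..b}" for x
    using ge[OF that] \<open>\<mu> > 0\<close> unfolding q_def by auto
  define G where "G x = - \<i> * cis (poly p x) / of_real (poly q x)" for x
  define E where "E x = \<i> * cis (poly p x) * of_real (poly r x / (poly q x)\<^sup>2)" for x
  have der: "(G has_vector_derivative (cis (poly p x) + E x)) (at x within {a..b})" if "x \<in> {a..b}" for x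
  proof -
    have "(G has_vector_derivative
        (- \<i> * (\<i> * of_real (poly q x) * cis (poly p x)) * of_real (inverse (poly q x))
        + - \<i> * cis (poly p x) * of_real (- (poly r x / (poly q x)\<^sup>2)))) (at x within {a..b})"
    proof -
      have 1: "((\<lambda>x. cis (poly p x)) has_vector_derivative (\<i> * of_real (poly q x) * cis (poly p x))) (at x within {a..b})"
      proof -
        have "(poly p has_derivative (*) (poly q x)) (at x within {a..b})"
          unfolding q_def using poly_DERIV[of p x]
          by (auto simp: has_field_derivative_def intro: has_derivative_at_withinI)
        then show ?thesis
          by (auto intro!: derivative_eq_intros simp: has_vector_derivative_def fun_eq_iff scaleR_conv_of_real)
      qed
      have 2: "((\<lambda>x. complex_of_real (inverse (poly q x))) has_vector_derivative of_real (- (poly r x / (poly q x)\<^sup>2))) (at x within {a..b})"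
      proof (rule has_vector_derivative_of_real)
        show "((\<lambda>x. inverse (poly q x)) has_real_derivative - (poly r x / (poly q x)\<^sup>2)) (at x within {a..b})"
          unfolding r_def using qpos[OF that]
          by (auto intro!: derivative_eq_intros
             simp: has_real_derivative_iff_has_vector_derivative[symmetric] power2_eq_square field_simps)
      qed
      from has_vector_derivative_mult[OF has_vector_derivative_mult_right[OF 1, of "-\<i>"] 2]
      show ?thesis by (simp add: G_def[abs_def] divide_inverse add_ac)
    qed
    then show ?thesis using qpos[OF that] by (simp add: E_def field_simps)
  qed
  have "((\<lambda>x. cis (poly p x) + E x) has_integral (G b - G a)) {a..b}"
    by (rule fundamental_theorem_of_calculus[OF assms(1) der])
  moreover have Eint: "E integrable_on {a..b}"
    unfolding E_def using qpos(2) by (intro integrable_continuous_real continuous_intros) auto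
  ultimately have eq: "integral {a..b} (\<lambda>x. cis (poly p x)) = G b - G a - integral {a..b} E"
    by (simp add: integral_add[symmetric] integral_unique algebra_simps)
  have Gn: "norm (G x) \<le> 1 / \<mu>" if "x \<in> {a..b}" for x
    using ge[OF that] \<open>\<mu> > 0\<close> qpos[OF that] unfolding G_def q_def
    by (simp add: norm_mult norm_divide frac_le)
  \<comment> \<open>The constant sign of p'' makes the norm of \<open>E\<close> an exact derivative,
    so its integral is a difference of two endpoint values and does not grow with the length of the
    interval.\<close>
  have sq: "((\<lambda>x. \<sigma> * (poly r x / (poly q x)\<^sup>2)) has_integral (- \<sigma> / poly q b - - \<sigma> / poly q a)) {a..b}"
  proof (rule fundamental_theorem_of_calculus[OF assms(1)])
    fix x assume x: "x \<in> {a..b}"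
    show "((\<lambda>x. - \<sigma> / poly q x) has_vector_derivative \<sigma> * (poly r x / (poly q x)\<^sup>2)) (at x within {a..b})"
      unfolding r_def using qpos[OF x]
      by (auto intro!: derivative_eq_intros
           simp: has_real_derivative_iff_has_vector_derivative[symmetric] power2_eq_square field_simps)
  qed
  have "norm (integral {a..b} E) \<le> integral {a..b} (\<lambda>x. \<sigma> * (poly r x / (poly q x)\<^sup>2))"
  proof (rule integral_norm_bound_integral[OF Eint])
    show "(\<lambda>x. \<sigma> * (poly r x / (poly q x)\<^sup>2)) integrable_on {a..b}" using sq by blast
    show "norm (E x) \<le> \<sigma> * (poly r x / (poly q x)\<^sup>2)" if "x \<in> {a..b}" for x
      using \<sigma>[OF that] unfolding E_def r_def q_def by (simp add: norm_mult norm_divide norm_power)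
  qed
  also have "\<dots> = \<sigma> * (1 / poly q a - 1 / poly q b)"
    using integral_unique[OF sq] by (simp add: algebra_simps)
  also have "\<dots> \<le> 1 / \<mu>"
  proof -
    have "0 < 1 / poly q x" "1 / poly q x \<le> 1 / \<mu>" if "x \<in> {a..b}" for x
      using ge[OF that] \<open>\<mu> > 0\<close> qpos[OF that] unfolding q_def by (simp_all add: frac_le)
    from this[of a] this[of b] \<open>a \<le> b\<close> have "\<bar>1 / poly q a - 1 / poly q b\<bar> \<le> 1 / \<mu>"
      unfolding atLeastAtMost_iff abs_le_iff by linarith
    moreover have "\<bar>\<sigma> * (1 / poly q a - 1 / poly q b)\<bar> = \<bar>1 / poly q a - 1 / poly q b\<bar>"
      using \<open>\<bar>\<sigma>\<bar> = 1\<close> by (simp add: abs_mult)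
    ultimately show ?thesis by linarith
  qed
  finally have "norm (integral {a..b} E) \<le> 1 / \<mu>" .
  moreover have "norm (G b - G a - integral {a..b} E) \<le> norm (G b) + norm (G a) + norm (integral {a..b} E)"
    using norm_triangle_ineq4[of "G b - G a" "integral {a..b} E"] norm_triangle_ineq4[of "G b" "G a"] by linarith
  ultimately show ?thesis using Gn[of a] Gn[of b] \<open>a \<le> b\<close> unfolding eq by simp
qed

lemma higher_pderiv_uminus: "(pderiv ^^ n) (- p) = - (pderiv ^^ n) p"
  for p :: "'a::idom poly"
  by (induction n) (auto simp: pderiv_minus)

text \<open>Induction on the order \<open>Suc n\<close> of the derivative bounded below. The
  constants satisfy K_0 = 3 and K_(n+1) = 2 K_n + 2 (two outer pieces and a middle piece of length
  at most 2 \<open>\<delta>\<close>), which solves to \<open>5 * 2 ^ n - 2\<close>. The sign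
  condition is asked only for \<open>n = 0\<close>; for higher orders it follows on the way
  down.\<close>

lemma van_der_Corput_higher_derivative:
  fixes p :: "real poly"
  assumes "a \<le> b" "\<mu> > 0"
    and "\<And>x. x \<in> {a..b} \<Longrightarrow> poly ((pderiv ^^ Suc n) p) x \<ge> \<mu>"
    and "n = 0 \<Longrightarrow> (\<forall>x\<in>{a..b}. poly (pderiv (pderiv p)) x \<ge> 0) \<or> (\<forall>x\<in>{a..b}. poly (pderiv (pderiv p)) x \<le> 0)"
  shows "norm (integral {a..b} (\<lambda>x. cis (poly p x))) \<le> (5 * 2 ^ n - 2) * \<mu> powr (- 1 / real (Suc n))"
  using assms
proof (induction n arbitrary: p a b \<mu>)
  case 0
  from "0.prems"(4) obtain \<sigma> :: real where "\<bar>\<sigma>\<bar> = 1"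
    "\<And>x. x \<in> {a..b} \<Longrightarrow> \<bar>poly (pderiv (pderiv p)) x\<bar> = \<sigma> * poly (pderiv (pderiv p)) x"
    by (metis abs_minus_cancel abs_of_nonneg abs_of_nonpos mult_1 mult_minus1 abs_one)
  then have "norm (integral {a..b} (\<lambda>x. cis (poly p x))) \<le> 3 / \<mu>"
    using "0.prems" by (intro van_der_Corput_first_derivative[where \<sigma> = \<sigma>]) auto
  then show ?case using \<open>\<mu> > 0\<close> by (simp add: powr_minus_divide)
next
  case (Suc n)
  define q where "q = (pderiv ^^ Suc n) p"
  define \<delta> where "\<delta> = \<mu> powr (- 1 / real (Suc (Suc n)))"
  define K :: real where "K = 5 * 2 ^ n - 2"
  have "\<delta> > 0" using Suc.prems by (simp add: \<delta>_def)
  have q': "poly (pderiv q) x \<ge> \<mu>" if "x \<in> {a..b}" for x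
    using Suc.prems(3)[OF that] by (simp add: q_def)
  have grow: "poly q y - poly q x \<ge> \<mu> * (y - x)" if "x \<in> {a..b}" "y \<in> {a..b}" "x \<le> y" for x y
  proof (cases "x = y")
    case False
    with that have "x < y" by simp
    from poly_MVT[OF this, of q] obtain z
      where "x < z" "z < y" "poly q y - poly q x = (y - x) * poly (pderiv q) z" by blast
    then show ?thesis using q'[of z] that by (auto simp: mult.commute mult_left_mono)
  qed auto
  \<comment> \<open>\<open>c\<close> is the zero of the increasing function \<open>q\<close>, or the endpoint nearest to it: away from \<open>c\<close> by \<open>\<delta>\<close>
    the lower derivative is large, and \<open>\<delta>\<close> balances the two contributions.\<close>
  obtain c where c: "c \<in> {a..b}"
    and cr: "\<And>x. x \<in> {a..b} \<Longrightarrow> c + \<delta> \<le> x \<Longrightarrow> poly q x \<ge> \<mu> * \<delta>"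
    and cl: "\<And>x. x \<in> {a..b} \<Longrightarrow> x \<le> c - \<delta> \<Longrightarrow> poly q x \<le> - (\<mu> * \<delta>)"
  proof -
    obtain c where c: "c \<in> {a..b}" "c = b \<or> poly q c \<ge> 0" "c = a \<or> poly q c \<le> 0"
    proof (cases "poly q a \<ge> 0 \<or> poly q b \<le> 0")
      case True
      then show ?thesis using that[of a] that[of b] \<open>a \<le> b\<close> by auto
    next
      case False
      then show ?thesis using poly_IVT_pos[of a b q] that \<open>a \<le> b\<close>
        by (metis atLeastAtMost_iff less_eq_real_def linorder_not_le order_refl)
    qed
    show ?thesis
    proof (rule that[of c])
      show "poly q x \<ge> \<mu> * \<delta>" if "x \<in> {a..b}" "c + \<delta> \<le> x" for x
      proof -
        have "\<mu> * \<delta> \<le> \<mu> * (x - c)" using that \<open>\<mu> > 0\<close> by simp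
        then show ?thesis using grow[of c x] c that \<open>\<delta> > 0\<close> by auto
      qed
      show "poly q x \<le> - (\<mu> * \<delta>)" if "x \<in> {a..b}" "x \<le> c - \<delta>" for x
      proof -
        have "\<mu> * \<delta> \<le> \<mu> * (c - x)" using that \<open>\<mu> > 0\<close> by simp
        then show ?thesis using grow[of x c] c that \<open>\<delta> > 0\<close> by auto
      qed
    qed (use c in auto)
  qed
  define l r where "l = max a (c - \<delta>)" and "r = min b (c + \<delta>)"
  have lr: "a \<le> l" "l \<le> r" "r \<le> b" using c \<open>\<delta> > 0\<close> by (auto simp: l_def r_def)
  \<comment> \<open>This identity dictates \<open>\<delta>\<close>: on the outer pieces the
    derivative of order \<open>Suc n\<close> is at least \<open>\<mu> * \<delta>\<close> in absolute
    value, and the induction hypothesis then yields a multiple of \<open>\<delta>\<close>, like the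
    trivial bound in the middle.\<close>
  have scale: "(\<mu> * \<delta>) powr (- 1 / real (Suc n)) = \<delta>"
  proof -
    have "\<mu> * \<delta> = \<mu> powr (1 + - 1 / real (Suc (Suc n)))"
      using \<open>\<mu> > 0\<close> by (simp add: \<delta>_def powr_mult_base)
    also have "1 + - 1 / real (Suc (Suc n)) = real (Suc n) / real (Suc (Suc n))"
      by (simp add: field_simps)
    finally have "(\<mu> * \<delta>) powr (- 1 / real (Suc n))
        = \<mu> powr (real (Suc n) / real (Suc (Suc n)) * (- 1 / real (Suc n)))"
      by (simp add: powr_powr)
    also have "real (Suc n) / real (Suc (Suc n)) * (- 1 / real (Suc n)) = - 1 / real (Suc (Suc n))"
      by (simp add: field_simps)
    finally show ?thesis unfolding \<delta>_def .
  qed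
  have K0: "K \<ge> 0" unfolding K_def using one_le_power[of "2::real" n] by linarith
  \<comment> \<open>For \<open>n = 0\<close> the polynomial \<open>q\<close> is p', so the lower
    bound on its derivative supplies the sign condition of the base case.\<close>
  have mono: "poly (pderiv (pderiv p)) x \<ge> 0" if "n = 0" "x \<in> {a..b}" for x
    using q'[of x] that \<open>\<mu> > 0\<close> by (auto simp: q_def)
  have left: "norm (integral {a..l} (\<lambda>x. cis (poly p x))) \<le> K * \<delta>"
  proof (cases "c - \<delta> \<le> a")
    case True
    then show ?thesis using K0 \<open>\<delta> > 0\<close> by (simp add: l_def max_def)
  next
    case False
    \<comment> \<open>Left of \<open>c\<close> the derivative \<open>q\<close> is very negative, so
      the induction hypothesis applies to \<open>- p\<close>; complex conjugation preserves the norm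
      of the integral.\<close>
    have "norm (integral {a..l} (\<lambda>x. cis (poly (- p) x))) \<le> K * (\<mu> * \<delta>) powr (- 1 / real (Suc n))"
      unfolding K_def
    proof (rule Suc.IH)
      show "poly ((pderiv ^^ Suc n) (- p)) x \<ge> \<mu> * \<delta>" if "x \<in> {a..l}" for x
        using cl[of x] that False lr by (simp add: higher_pderiv_uminus q_def l_def pderiv_minus)
      show "(\<forall>x\<in>{a..l}. 0 \<le> poly (pderiv (pderiv (- p))) x) \<or> (\<forall>x\<in>{a..l}. poly (pderiv (pderiv (- p))) x \<le> 0)"
        if "n = 0" using mono[OF that] lr by (auto simp: pderiv_minus)
    qed (use lr \<open>\<mu> > 0\<close> \<open>\<delta> > 0\<close> in auto)
    then show ?thesis unfolding scale by (simp add: norm_integral_cis_uminus)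
  qed
  have right: "norm (integral {r..b} (\<lambda>x. cis (poly p x))) \<le> K * \<delta>"
  proof (cases "c + \<delta> \<ge> b")
    case True
    then show ?thesis using K0 \<open>\<delta> > 0\<close> by (simp add: r_def min_def)
  next
    case False
    have "norm (integral {r..b} (\<lambda>x. cis (poly p x))) \<le> K * (\<mu> * \<delta>) powr (- 1 / real (Suc n))"
      unfolding K_def
    proof (rule Suc.IH)
      show "poly ((pderiv ^^ Suc n) p) x \<ge> \<mu> * \<delta>" if "x \<in> {r..b}" for x
        using cr[of x] that False lr by (simp add: q_def r_def)
      show "(\<forall>x\<in>{r..b}. 0 \<le> poly (pderiv (pderiv p)) x) \<or> (\<forall>x\<in>{r..b}. poly (pderiv (pderiv p)) x \<le> 0)"
        if "n = 0" using mono[OF that] lr by auto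
    qed (use lr \<open>\<mu> > 0\<close> \<open>\<delta> > 0\<close> in auto)
    then show ?thesis unfolding scale .
  qed
  have mid: "norm (integral {l..r} (\<lambda>x. cis (poly p x))) \<le> 2 * \<delta>"
    using norm_integral_cis_poly_le_length[OF lr(2), of p] c \<open>\<delta> > 0\<close> by (auto simp: l_def r_def)
  have "integral {a..b} (\<lambda>x. cis (poly p x)) = integral {a..l} (\<lambda>x. cis (poly p x))
      + integral {l..r} (\<lambda>x. cis (poly p x)) + integral {r..b} (\<lambda>x. cis (poly p x))"
    using lr Henstock_Kurzweil_Integration.integral_combine[of a l r "\<lambda>x. cis (poly p x)"]
      Henstock_Kurzweil_Integration.integral_combine[of a r b "\<lambda>x. cis (poly p x)"] by simp
  then have "norm (integral {a..b} (\<lambda>x. cis (poly p x))) \<le> K * \<delta> + 2 * \<delta> + K * \<delta>"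
    using left mid right by (metis (no_types, lifting) add_mono norm_triangle_le)
  also have "\<dots> = (5 * 2 ^ Suc n - 2) * \<delta>" by (simp add: K_def algebra_simps)
  finally show ?case unfolding \<delta>_def .
qed

lemma higher_pderiv_degree_le:
  fixes p :: "real poly"
  assumes "degree p \<le> n"
  shows "(pderiv ^^ n) p = [:fact n * coeff p n:]"
proof (rule poly_eqI)
  fix i show "coeff ((pderiv ^^ n) p) i = coeff [:fact n * coeff p n:] i"
    using assms by (cases i) (auto simp: coeff_higher_pderiv pochhammer_fact coeff_eq_0)
qed

text \<open>The \<open>n\<close>-th derivative is the constant \<open>fact n * coeff p n\<close>.
  The bound involves neither the lower coefficients nor the interval, which later gives uniformity
  in the base point and control of all initial subintervals.\<close>

lemma van_der_Corput_poly:
  fixes p :: "real poly"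
  assumes "a \<le> b" "n \<ge> 1" "degree p \<le> n" "coeff p n \<noteq> 0"
  shows "norm (integral {a..b} (\<lambda>x. cis (poly p x)))
    \<le> 5 * 2 ^ n * (fact n * \<bar>coeff p n\<bar>) powr (- 1 / real n)"
proof -
  obtain m where m: "n = Suc m" using assms by (cases n) auto
  have pos: "norm (integral {a..b} (\<lambda>x. cis (poly q x)))
      \<le> (5 * 2 ^ m - 2) * (fact n * coeff q n) powr (- 1 / real n)"
    if "degree q \<le> n" "coeff q n > 0" for q :: "real poly"
    unfolding m
  proof (rule van_der_Corput_higher_derivative)
    show "poly ((pderiv ^^ Suc m) q) x \<ge> fact (Suc m) * coeff q (Suc m)" for x
      using higher_pderiv_degree_le[OF that(1)] unfolding m by simp
    show "(\<forall>x\<in>{a..b}. 0 \<le> poly (pderiv (pderiv q)) x) \<or> (\<forall>x\<in>{a..b}. poly (pderiv (pderiv q)) x \<le> 0)" if "m = 0"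
      using higher_pderiv_degree_le[OF \<open>degree q \<le> n\<close>] that by (auto simp: m pderiv_pCons)
  qed (use assms that in \<open>auto simp: m\<close>)
  have "norm (integral {a..b} (\<lambda>x. cis (poly p x)))
      \<le> (5 * 2 ^ m - 2) * (fact n * \<bar>coeff p n\<bar>) powr (- 1 / real n)"
    using pos[of p] pos[of "- p"] assms
    by (cases "coeff p n > 0") (auto simp: norm_integral_cis_uminus)
  also have "\<dots> \<le> 5 * 2 ^ n * (fact n * \<bar>coeff p n\<bar>) powr (- 1 / real n)"
    using zero_le_power[of "2::real" m] by (intro mult_right_mono) (auto simp: m simp del: zero_le_power)
  finally show ?thesis .
qed

text \<open>Integration by parts against the primitive \<open>E\<close> of \<open>e\<close>, bounded
  by \<open>M\<close> throughout. Since \<open>E\<close> vanishes at \<open>a\<close>, only the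
  endpoint value at \<open>b\<close> survives.\<close>

lemma norm_integral_mult_le_variation:
  fixes e :: "real \<Rightarrow> complex" and \<psi> \<psi>' :: "real \<Rightarrow> real"
  assumes "a \<le> b" and e: "continuous_on {a..b} e"
    and \<psi>: "\<And>x. x \<in> {a..b} \<Longrightarrow> (\<psi> has_real_derivative \<psi>' x) (at x)"
    and \<psi>': "continuous_on {a..b} \<psi>'"
    and M: "\<And>x. x \<in> {a..b} \<Longrightarrow> norm (integral {a..x} e) \<le> M"
  shows "norm (integral {a..b} (\<lambda>x. e x * of_real (\<psi> x))) \<le> M * (\<bar>\<psi> b\<bar> + integral {a..b} (\<lambda>x. \<bar>\<psi>' x\<bar>))"
proof -
  define E where "E x = integral {a..x} e" for x
  have E: "(E has_vector_derivative e x) (at x within {a..b})" if "x \<in> {a..b}" for x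
    unfolding E_def using integral_has_vector_derivative[OF e that] .
  have contE: "continuous_on {a..b} E"
    using E by (rule continuous_on_vector_derivative)
  have cont\<psi>: "continuous_on {a..b} \<psi>"
    using \<psi> by (meson DERIV_isCont continuous_at_imp_continuous_on)
  have "((\<lambda>x. E x * of_real (\<psi>' x) + e x * of_real (\<psi> x)) has_integral (E b * of_real (\<psi> b) - E a * of_real (\<psi> a))) {a..b}"
    by (intro fundamental_theorem_of_calculus assms has_vector_derivative_mult E has_vector_derivative_of_real)
      (auto intro: DERIV_subset[OF \<psi>])
  moreover have i1: "(\<lambda>x. E x * of_real (\<psi>' x)) integrable_on {a..b}"
    by (intro integrable_continuous_real continuous_intros contE \<psi>')
  moreover have "(\<lambda>x. e x * of_real (\<psi> x)) integrable_on {a..b}"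
    by (intro integrable_continuous_real continuous_intros e cont\<psi>)
  ultimately have eq: "integral {a..b} (\<lambda>x. e x * of_real (\<psi> x)) =
      E b * of_real (\<psi> b) - integral {a..b} (\<lambda>x. E x * of_real (\<psi>' x))"
    by (simp add: integral_add[symmetric] integral_unique E_def algebra_simps)
  have "norm (integral {a..b} (\<lambda>x. E x * of_real (\<psi>' x))) \<le> integral {a..b} (\<lambda>x. M * \<bar>\<psi>' x\<bar>)"
    by (intro integral_norm_bound_integral i1 integrable_continuous_real continuous_intros \<psi>')
      (auto simp: norm_mult E_def intro!: mult_right_mono M)
  moreover have "norm (E b * of_real (\<psi> b)) \<le> M * \<bar>\<psi> b\<bar>"
    using M[of b] \<open>a \<le> b\<close> by (auto simp: norm_mult E_def intro!: mult_right_mono)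
  ultimately show ?thesis unfolding eq
    using norm_triangle_ineq4[of "E b * of_real (\<psi> b)" "integral {a..b} (\<lambda>x. E x * of_real (\<psi>' x))"]
    by (simp add: distrib_left)
qed

section \<open>Restriction of a multivariate polynomial to a line\<close>

text \<open>Working with upper bounds instead of exact degrees keeps the rule valid when a top
  coefficient is zero, as for the factor \<open>[:x $ i, v $ i:]\<close> with
  \<open>v $ i = 0\<close>.\<close>

lemma coeff_mult_degree_le:
  fixes p q :: "'a::comm_semiring_0 poly"
  assumes "degree p \<le> m" "degree q \<le> n"
  shows "coeff (p * q) (m + n) = coeff p m * coeff q n"
proof -
  have "coeff (p * q) (m + n) = (\<Sum>i\<le>m+n. coeff p i * coeff q (m + n - i))"
    by (rule coeff_mult)
  also have "\<dots> = (\<Sum>i\<in>{m}. coeff p i * coeff q (m + n - i))"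
  proof (intro sum.mono_neutral_right ballI)
    fix i assume "i \<in> {..m + n} - {m}"
    then have "i > m \<or> m + n - i > n" by auto
    then show "coeff p i * coeff q (m + n - i) = 0" using assms by (auto simp: coeff_eq_0)
  qed auto
  finally show ?thesis by simp
qed

lemma degree_prod_le_sum:
  fixes p :: "'i \<Rightarrow> 'a::comm_semiring_1 poly"
  assumes "finite I" "\<And>i. i \<in> I \<Longrightarrow> degree (p i) \<le> n i"
  shows "degree (\<Prod>i\<in>I. p i) \<le> (\<Sum>i\<in>I. n i)"
  using assms
  by (induction I rule: finite_induct) (auto intro!: order_trans[OF degree_mult_le] add_mono)

lemma coeff_prod_degree_le:
  fixes p :: "'i \<Rightarrow> 'a::comm_semiring_1 poly"
  assumes "finite I" "\<And>i. i \<in> I \<Longrightarrow> degree (p i) \<le> n i"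
  shows "coeff (\<Prod>i\<in>I. p i) (\<Sum>i\<in>I. n i) = (\<Prod>i\<in>I. coeff (p i) (n i))"
  using assms
  by (induction I rule: finite_induct) (auto simp: coeff_mult_degree_le degree_prod_le_sum)

lemma degree_linear_power_le: "degree ([:a, b:] ^ n) \<le> n"
  for a b :: "'a::comm_semiring_1"
  using degree_power_le[of "[:a, b:]" n] degree_pCons_le[of a "[:b:]"]
  by (metis degree_pCons_0 le_trans mult.commute mult_le_mono1 nat_mult_1 One_nat_def)

lemma coeff_linear_power: "coeff ([:a, b:] ^ n) n = b ^ n"
  for a b :: "'a::comm_semiring_1"
proof (induction n)
  case (Suc n)
  have "degree [:a, b:] \<le> 1" by simp
  then show ?case using coeff_mult_degree_le[of "[:a, b:]" 1 "[:a, b:] ^ n" n] Suc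
    by (simp add: degree_linear_power_le)
qed auto

definition line_poly :: "(('n::finite \<Rightarrow> nat) \<Rightarrow> real) \<Rightarrow> real^'n \<Rightarrow> real^'n \<Rightarrow> real poly" where
  "line_poly c x v = (\<Sum>\<alpha>\<in>{\<alpha>. c \<alpha> \<noteq> 0}. smult (c \<alpha>) (\<Prod>i\<in>UNIV. [:x $ i, v $ i:] ^ \<alpha> i))"

text \<open>The homogeneous component of highest degree, evaluated at \<open>v\<close>.\<close>

definition top_form :: "(('n::finite \<Rightarrow> nat) \<Rightarrow> real) \<Rightarrow> real^'n \<Rightarrow> real" where
  "top_form c v = (\<Sum>\<alpha>\<in>{\<alpha>. c \<alpha> \<noteq> 0 \<and> sum \<alpha> UNIV = mpoly_degree c}. c \<alpha> * (\<Prod>i\<in>UNIV. (v $ i) ^ \<alpha> i))"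

lemma poly_line_poly: "poly (line_poly c x v) s = mpoly_eval c (x + s *\<^sub>R v)"
  by (simp add: line_poly_def mpoly_eval_def poly_sum poly_prod)

lemma mpoly_degree_ge:
  assumes "mpoly_coeffs c" "c \<alpha> \<noteq> 0"
  shows "sum \<alpha> UNIV \<le> mpoly_degree c"
  using assms unfolding mpoly_degree_def mpoly_coeffs_def by (intro Max_ge) auto

text \<open>The extra 0 inserted under \<open>Max\<close> could be the maximum without belonging to
  any monomial; a nonzero degree excludes this.\<close>

lemma mpoly_degree_attained:
  assumes "mpoly_coeffs c" "mpoly_degree c \<noteq> 0"
  obtains \<alpha> where "c \<alpha> \<noteq> 0" "sum \<alpha> UNIV = mpoly_degree c"
proof -
  have "mpoly_degree c \<in> insert 0 ((\<lambda>\<alpha>. \<Sum>i\<in>UNIV. \<alpha> i) ` {\<alpha>. c \<alpha> \<noteq> 0})"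
    unfolding mpoly_degree_def by (rule Max_in) (use assms in \<open>auto simp: mpoly_coeffs_def\<close>)
  then show ?thesis using assms(2) that by auto
qed

lemma degree_line_poly:
  assumes "mpoly_coeffs c"
  shows "degree (line_poly c x v) \<le> mpoly_degree c"
  unfolding line_poly_def
proof (rule degree_sum_le)
  fix \<alpha> assume "\<alpha> \<in> {\<alpha>. c \<alpha> \<noteq> 0}"
  then have "sum \<alpha> UNIV \<le> mpoly_degree c" using mpoly_degree_ge[OF assms] by auto
  moreover have "degree (\<Prod>i\<in>UNIV. [:x $ i, v $ i:] ^ \<alpha> i) \<le> sum \<alpha> UNIV"
    by (intro degree_prod_le_sum degree_linear_power_le) auto
  ultimately show "degree (smult (c \<alpha>) (\<Prod>i\<in>UNIV. [:x $ i, v $ i:] ^ \<alpha> i)) \<le> mpoly_degree c"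
    by (meson degree_smult_le le_trans)
qed (use assms in \<open>simp add: mpoly_coeffs_def\<close>)

lemma coeff_line_poly:
  assumes "mpoly_coeffs c"
  shows "coeff (line_poly c x v) (mpoly_degree c) = top_form c v"
proof -
  have "coeff (line_poly c x v) (mpoly_degree c) =
     (\<Sum>\<alpha>\<in>{\<alpha>. c \<alpha> \<noteq> 0}. c \<alpha> * coeff (\<Prod>i\<in>UNIV. [:x $ i, v $ i:] ^ \<alpha> i) (mpoly_degree c))"
    by (simp add: line_poly_def coeff_sum)
  also have "\<dots> = (\<Sum>\<alpha>\<in>{\<alpha>. c \<alpha> \<noteq> 0 \<and> sum \<alpha> UNIV = mpoly_degree c}.
      c \<alpha> * coeff (\<Prod>i\<in>UNIV. [:x $ i, v $ i:] ^ \<alpha> i) (mpoly_degree c))"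
  proof (intro sum.mono_neutral_right ballI)
    fix \<alpha> assume "\<alpha> \<in> {\<alpha>. c \<alpha> \<noteq> 0} - {\<alpha>. c \<alpha> \<noteq> 0 \<and> sum \<alpha> UNIV = mpoly_degree c}"
    then have "sum \<alpha> UNIV < mpoly_degree c" using mpoly_degree_ge[OF assms, of \<alpha>] by auto
    moreover have "degree (\<Prod>i\<in>UNIV. [:x $ i, v $ i:] ^ \<alpha> i) \<le> sum \<alpha> UNIV"
      by (intro degree_prod_le_sum degree_linear_power_le) auto
    ultimately show "c \<alpha> * coeff (\<Prod>i\<in>UNIV. [:x $ i, v $ i:] ^ \<alpha> i) (mpoly_degree c) = 0"
      by (simp add: coeff_eq_0)
  qed (use assms in \<open>auto simp: mpoly_coeffs_def\<close>)
  also have "\<dots> = top_form c v"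
    unfolding top_form_def
  proof (intro sum.cong refl arg_cong2[where f = "(*)"])
    fix \<alpha> assume "\<alpha> \<in> {\<alpha>. c \<alpha> \<noteq> 0 \<and> sum \<alpha> UNIV = mpoly_degree c}"
    then have "mpoly_degree c = sum \<alpha> UNIV" by auto
    then show "coeff (\<Prod>i\<in>UNIV. [:x $ i, v $ i:] ^ \<alpha> i) (mpoly_degree c) = (\<Prod>i\<in>UNIV. v $ i ^ \<alpha> i)"
      by (simp add: coeff_prod_degree_le degree_linear_power_le coeff_linear_power)
  qed
  finally show ?thesis .
qed

section \<open>A direction in which the top-degree form does not vanish\<close>

lemma digit_sum_less:
  fixes a :: "nat \<Rightarrow> nat"
  assumes "\<And>j. j < n \<Longrightarrow> a j < N"
  shows "(\<Sum>j<n. a j * N ^ j) < N ^ n"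
  using assms
proof (induction n)
  case (Suc n)
  have "Suc (a n) * N ^ n \<le> N * N ^ n" using Suc.prems[of n] by (intro mult_right_mono) auto
  then show ?case using Suc by fastforce
qed auto

text \<open>Uniqueness of base-\<open>N\<close> digits: the lower digits sum to less than
  \<open>N ^ n\<close>, so division by \<open>N ^ n\<close> recovers the top digit, and induction
  handles the rest.\<close>

lemma digit_sum_inj:
  fixes a b :: "nat \<Rightarrow> nat"
  assumes "\<And>j. j < n \<Longrightarrow> a j < N" "\<And>j. j < n \<Longrightarrow> b j < N"
    and "(\<Sum>j<n. a j * N ^ j) = (\<Sum>j<n. b j * N ^ j)" "j < n"
  shows "a j = b j"
  using assms
proof (induction n)
  case (Suc n)
  have la: "(\<Sum>j<n. a j * N ^ j) < N ^ n" and lb: "(\<Sum>j<n. b j * N ^ j) < N ^ n"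
    using Suc.prems by (auto intro!: digit_sum_less)
  have "N ^ n \<noteq> 0" using la by linarith
  have "a n = (\<Sum>j<Suc n. a j * N ^ j) div N ^ n" using la \<open>N ^ n \<noteq> 0\<close> by simp
  also have "\<dots> = b n" unfolding Suc.prems(3) using lb \<open>N ^ n \<noteq> 0\<close> by simp
  finally have "a n = b n" .
  then show ?case using Suc by (cases "j = n") auto
qed auto

text \<open>Kronecker substitution \<open>v\<^sub>i = s ^ (N ^ e i)\<close>: with \<open>N\<close> above all exponents, distinct multi-indices
  are distinct digit strings in base \<open>N\<close>, hence give distinct powers of \<open>s\<close>.\<close>
lemma exists_nonzero_of_coeffs:
  fixes c :: "('n::finite \<Rightarrow> nat) \<Rightarrow> real"
  assumes "finite S" "\<alpha>\<^sub>0 \<in> S" "c \<alpha>\<^sub>0 \<noteq> 0"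
  shows "\<exists>v :: real^'n. (\<Sum>\<alpha>\<in>S. c \<alpha> * (\<Prod>i\<in>UNIV. (v $ i) ^ \<alpha> i)) \<noteq> 0"
proof -
  obtain e :: "'n \<Rightarrow> nat" where e: "bij_betw e UNIV {..<CARD('n)}"
    \<comment> \<open>Numbering the coordinates from 0 turns them into digit positions.\<close>
    using ex_bij_betw_finite_nat[of "UNIV :: 'n set"] by (auto simp: atLeast0LessThan)
  define N where "N = Suc (Max ((\<lambda>(\<alpha>, i). \<alpha> i) ` (S \<times> UNIV)))"
  have N: "\<alpha> i < N" if "\<alpha> \<in> S" for \<alpha> i
    unfolding N_def less_Suc_eq_le by (rule Max_ge) (use that assms(1) in auto)
  define w where "w \<alpha> = (\<Sum>i\<in>UNIV. \<alpha> i * N ^ e i)" for \<alpha> :: "'n \<Rightarrow> nat"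
  have inv_e: "inv_into UNIV e (e i) = i" for i
    using e by (simp add: bij_betw_def)
  have w: "w \<alpha> = (\<Sum>j<CARD('n). \<alpha> (inv_into UNIV e j) * N ^ j)" for \<alpha>
    using sum.reindex_bij_betw[OF e, of "\<lambda>j. \<alpha> (inv_into UNIV e j) * N ^ j"]
    by (simp add: w_def inv_e)
  have inj: "inj_on w S"
  proof (rule inj_onI, rule ext)
    fix \<alpha> \<beta> i assume "\<alpha> \<in> S" "\<beta> \<in> S" "w \<alpha> = w \<beta>"
    moreover have "e i < CARD('n)" using bij_betwE[OF e] by auto
    ultimately have "\<alpha> (inv_into UNIV e (e i)) = \<beta> (inv_into UNIV e (e i))"
      unfolding w by (intro digit_sum_inj[of "CARD('n)" "\<lambda>j. \<alpha> (inv_into UNIV e j)" N]) (auto simp: N)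
    then show "\<alpha> i = \<beta> i" by (simp only: inv_e)
  qed
  \<comment> \<open>\<open>P\<close> is the form after the substitution, as a polynomial in
    \<open>s\<close>. Injectivity of \<open>w\<close> prevents cancellation, and a nonzero real
    polynomial has a point where it does not vanish.\<close>
  define P where "P = (\<Sum>\<alpha>\<in>S. monom (c \<alpha>) (w \<alpha>))"
  have "coeff P (w \<alpha>\<^sub>0) = (\<Sum>\<alpha>\<in>S. if \<alpha> = \<alpha>\<^sub>0 then c \<alpha> else 0)"
    unfolding P_def coeff_sum
    by (intro sum.cong refl) (use inj assms in \<open>auto simp: inj_on_def\<close>)
  then have "P \<noteq> 0" using assms by auto
  then obtain s where s: "poly P s \<noteq> 0" using poly_all_0_iff_0 by blast
  have "poly P s = (\<Sum>\<alpha>\<in>S. c \<alpha> * (\<Prod>i\<in>UNIV. ((\<chi> i. s ^ (N ^ e i)) $ i) ^ \<alpha> i))"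
    by (simp add: P_def poly_sum poly_monom w_def power_sum power_mult[symmetric] mult.commute)
  then show ?thesis using s by metis
qed

lemma exists_top_form_nonzero:
  assumes "mpoly_coeffs c" "mpoly_degree c \<noteq> 0"
  obtains v where "top_form c v \<noteq> 0"
proof -
  obtain \<alpha> where "c \<alpha> \<noteq> 0" "sum \<alpha> UNIV = mpoly_degree c"
    using mpoly_degree_attained[OF assms] .
  then have "\<exists>v. top_form c v \<noteq> 0"
    unfolding top_form_def using assms
    by (intro exists_nonzero_of_coeffs[of _ \<alpha>]) (auto simp: mpoly_coeffs_def)
  then show ?thesis using that by blast
qed

section \<open>Averaging over segments\<close>

lemma norm_oscillatory_integral_poly_le:
  fixes p :: "real poly" and \<psi> \<psi>' :: "real \<Rightarrow> real"
  assumes "a \<le> b" "n \<ge> 1" "degree p \<le> n" "coeff p n \<noteq> 0"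
    and "\<And>x. x \<in> {a..b} \<Longrightarrow> (\<psi> has_real_derivative \<psi>' x) (at x)"
    and "continuous_on {a..b} \<psi>'"
  shows "norm (integral {a..b} (\<lambda>x. cis (poly p x) * of_real (\<psi> x)))
    \<le> 5 * 2 ^ n * (fact n * \<bar>coeff p n\<bar>) powr (- 1 / real n) * (\<bar>\<psi> b\<bar> + integral {a..b} (\<lambda>x. \<bar>\<psi>' x\<bar>))"
  using assms by (intro norm_integral_mult_le_variation van_der_Corput_poly continuous_intros) auto

lemma integrable_lborel_compact_support:
  fixes h :: "'a::euclidean_space \<Rightarrow> 'b::{banach, second_countable_topology}"
  assumes "continuous_on UNIV h" "compact K" "\<And>x. x \<notin> K \<Longrightarrow> h x = 0"
  shows "integrable lborel h"
proof -
  have "integrable lborel (\<lambda>x. indicator K x *\<^sub>R h x)"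
    using assms by (intro borel_integrable_compact continuous_on_subset[OF assms(1)]) auto
  also have "(\<lambda>x. indicator K x *\<^sub>R h x) = h" using assms(3) by (auto simp: fun_eq_iff indicator_def)
  finally show ?thesis .
qed

lemma lborel_integral_translation:
  fixes h :: "'a::euclidean_space \<Rightarrow> 'b::{banach, second_countable_topology}"
  assumes "h \<in> borel_measurable borel"
  shows "(\<integral>x. h (x + a) \<partial>lborel) = (\<integral>x. h x \<partial>lborel)"
proof -
  have "(\<integral>x. h x \<partial>lborel) = (\<integral>x. h x \<partial>distr lborel borel ((+) a))"
    by (simp add: lborel_distr_plus)
  also have "\<dots> = (\<integral>x. h (a + x) \<partial>lborel)"
    using assms by (intro integral_distr) auto
  finally show ?thesis by (simp add: add.commute)
qed

text \<open>The value type is general because the identity is needed twice: for the complex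
  oscillating integrand and for the norm of the gradient.\<close>

lemma lborel_integral_segment_average:
  fixes h :: "'a::euclidean_space \<Rightarrow> 'b::euclidean_space"
  assumes cont: "continuous_on UNIV h" and "compact K" and supp: "\<And>x. x \<notin> K \<Longrightarrow> h x = 0"
  shows "integrable lborel (\<lambda>x. integral {0..1} (\<lambda>s. h (x + s *\<^sub>R v)))" (is ?int)
    and "(\<integral>x. integral {0..1} (\<lambda>s. h (x + s *\<^sub>R v)) \<partial>lborel) = (\<integral>x. h x \<partial>lborel)" (is ?eq)
proof -
  define F where "F s x = indicator {0..1} s *\<^sub>R h (x + s *\<^sub>R v)" for s :: real and x
  obtain R where R: "K \<subseteq> cball 0 R" using compact_imp_bounded[OF \<open>compact K\<close>] by (auto simp: bounded_iff subset_iff)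
  \<comment> \<open>Moving by \<open>s *\<^sub>R v\<close> with \<open>s\<close> in [0,1] shifts a
    point by at most \<open>norm v\<close>, so the integrand vanishes off the compact set
    \<open>Q\<close>. This gives the joint integrability that Fubini requires.\<close>
  define Q where "Q = {0..1::real} \<times> cball (0::'a) (R + norm v)"
  have "integrable lborel (\<lambda>z. indicator Q z *\<^sub>R h (snd z + fst z *\<^sub>R v))"
    unfolding Q_def
    by (intro borel_integrable_compact compact_Times continuous_on_compose2[OF cont] continuous_intros) auto
  also have "(\<lambda>z. indicator Q z *\<^sub>R h (snd z + fst z *\<^sub>R v)) = case_prod F"
  proof (rule ext, clarify)
    fix s x
    have "h (x + s *\<^sub>R v) = 0" if "s \<in> {0..1}" "x \<notin> cball 0 (R + norm v)"
    proof -
      have "norm x \<le> norm (x + s *\<^sub>R v) + norm (s *\<^sub>R v)"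
        using norm_triangle_ineq4[of "x + s *\<^sub>R v" "s *\<^sub>R v"] by simp
      moreover have "norm (s *\<^sub>R v) \<le> norm v" using that by (simp add: mult_left_le_one_le)
      ultimately have "x + s *\<^sub>R v \<notin> cball 0 R" using that by auto
      then show ?thesis using R supp by blast
    qed
    then show "indicator Q (s, x) *\<^sub>R h (snd (s, x) + fst (s, x) *\<^sub>R v) = F s x"
      by (auto simp: F_def Q_def indicator_def)
  qed
  finally have int: "integrable (lborel \<Otimes>\<^sub>M lborel) (case_prod F)" by (simp add: lborel_prod)
  have inner: "(\<integral>s. F s x \<partial>lborel) = integral {0..1} (\<lambda>s. h (x + s *\<^sub>R v))" for x
  proof -
    have "set_integrable lborel {0..1} (\<lambda>s. h (x + s *\<^sub>R v))"
      unfolding set_integrable_def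
      by (intro borel_integrable_compact continuous_on_compose2[OF cont] continuous_intros) auto
    from set_borel_integral_eq_integral(2)[OF this] show ?thesis
      unfolding F_def set_lebesgue_integral_def .
  qed
  show ?int using lborel_pair.integrable_snd[OF int] unfolding inner .
  have meas: "h \<in> borel_measurable borel" using cont by (rule borel_measurable_continuous_onI)
  have "(\<integral>x. integral {0..1} (\<lambda>s. h (x + s *\<^sub>R v)) \<partial>lborel) = (\<integral>s. \<integral>x. F s x \<partial>lborel \<partial>lborel)"
    using lborel_pair.Fubini_integral[OF int] unfolding inner .
  \<comment> \<open>After translation the integral over \<open>x\<close> no longer depends on
    \<open>s\<close>, and [0,1] has length 1.\<close>
  also have "\<dots> = (\<integral>s. indicator {0..1::real} s *\<^sub>R (\<integral>x. h x \<partial>lborel) \<partial>lborel)"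
    unfolding F_def by (simp add: lborel_integral_translation[OF meas])
  also have "\<dots> = (\<integral>x. h x \<partial>lborel)" by simp
  finally show ?eq .
qed

section \<open>Bounds along segments and their integration over the base point\<close>

lemma continuous_on_mpoly_eval: "continuous_on S (mpoly_eval c)"
  unfolding mpoly_eval_def[abs_def] by (intro continuous_intros)

lemma oscillatory_integral_segment_bound:
  fixes g :: "real^'n::finite \<Rightarrow> real" and g' :: "real^'n \<Rightarrow> real^'n"
  assumes c: "mpoly_coeffs c" "mpoly_degree c = d" "d \<ge> 1"
    and v: "top_form c v \<noteq> 0" and "t > 0"
    and g: "\<And>x. (g has_derivative (\<lambda>h. g' x \<bullet> h)) (at x)" and g': "continuous_on UNIV g'"
  shows "norm (integral {0..1} (\<lambda>s. cis (t * mpoly_eval c (x + s *\<^sub>R v)) * complex_of_real (g (x + s *\<^sub>R v))))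
     \<le> 5 * 2 ^ d * (fact d * \<bar>top_form c v\<bar>) powr (- 1 / real d) * t powr (- 1 / real d)
       * (\<bar>g (x + v)\<bar> + norm v * integral {0..1} (\<lambda>s. norm (g' (x + s *\<^sub>R v))))"
proof -
  define p where "p = smult t (line_poly c x v)"
  define \<psi>' where "\<psi>' s = g' (x + s *\<^sub>R v) \<bullet> v" for s :: real
  have coeff: "coeff p d = t * top_form c v"
    using coeff_line_poly[OF c(1)] c(2) by (simp add: p_def)
  have cont: "continuous_on S (\<lambda>s. g' (x + s *\<^sub>R v))" for S
    by (intro continuous_on_compose2[OF g'] continuous_intros) auto
  have der: "((\<lambda>s. g (x + s *\<^sub>R v)) has_real_derivative \<psi>' s) (at s)" for s
  proof -
    have "((\<lambda>s. g (x + s *\<^sub>R v)) has_derivative (\<lambda>h. g' (x + s *\<^sub>R v) \<bullet> (h *\<^sub>R v))) (at s)"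
      by (rule has_derivative_compose[OF _ g]) (auto intro!: derivative_eq_intros)
    then show ?thesis unfolding has_field_derivative_def
      by (rule has_derivative_eq_rhs) (auto simp: \<psi>'_def)
  qed
  have "norm (integral {0..1} (\<lambda>s. cis (poly p s) * complex_of_real (g (x + s *\<^sub>R v))))
    \<le> 5 * 2 ^ d * (fact d * \<bar>coeff p d\<bar>) powr (- 1 / real d)
      * (\<bar>g (x + 1 *\<^sub>R v)\<bar> + integral {0..1} (\<lambda>s. \<bar>\<psi>' s\<bar>))"
  proof (rule norm_oscillatory_integral_poly_le)
    show "degree p \<le> d"
      using degree_line_poly[OF c(1), of x v] c(2) by (simp add: p_def)
    show "coeff p d \<noteq> 0" using v \<open>t > 0\<close> coeff by simp
    show "continuous_on {0..1} \<psi>'" unfolding \<psi>'_def by (intro continuous_intros cont)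
  qed (use c der in auto)
  \<comment> \<open>The decay in \<open>t\<close> arises here: the leading coefficient of the phase
    is linear in \<open>t\<close>.\<close>
  also have "(fact d * \<bar>coeff p d\<bar>) powr (- 1 / real d)
      = (fact d * \<bar>top_form c v\<bar>) powr (- 1 / real d) * t powr (- 1 / real d)"
    using \<open>t > 0\<close> by (simp add: coeff abs_mult powr_mult[symmetric] mult_ac)
  finally have "norm (integral {0..1} (\<lambda>s. cis (poly p s) * complex_of_real (g (x + s *\<^sub>R v))))
      \<le> 5 * 2 ^ d * ((fact d * \<bar>top_form c v\<bar>) powr (- 1 / real d) * t powr (- 1 / real d))
      * (\<bar>g (x + 1 *\<^sub>R v)\<bar> + integral {0..1} (\<lambda>s. \<bar>\<psi>' s\<bar>))" .
  also have "\<dots> \<le> 5 * 2 ^ d * ((fact d * \<bar>top_form c v\<bar>) powr (- 1 / real d) * t powr (- 1 / real d))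
      * (\<bar>g (x + 1 *\<^sub>R v)\<bar> + norm v * integral {0..1} (\<lambda>s. norm (g' (x + s *\<^sub>R v))))"
  proof (intro mult_left_mono add_mono order_refl)
    have "\<bar>\<psi>' s\<bar> \<le> norm v * norm (g' (x + s *\<^sub>R v))" for s
      unfolding \<psi>'_def by (metis Cauchy_Schwarz_ineq2 mult.commute)
    then have "integral {0..1} (\<lambda>s. \<bar>\<psi>' s\<bar>) \<le> integral {0..1} (\<lambda>s. norm v * norm (g' (x + s *\<^sub>R v)))"
      unfolding \<psi>'_def
      by (intro integral_le integrable_continuous_real continuous_intros cont) auto
    then show "integral {0..1} (\<lambda>s. \<bar>\<psi>' s\<bar>) \<le> norm v * integral {0..1} (\<lambda>s. norm (g' (x + s *\<^sub>R v)))"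
      by simp
  qed auto
  finally show ?thesis by (simp add: p_def poly_line_poly mult.assoc)
qed

text \<open>Off the closed support \<open>g\<close> is locally zero, and derivatives are unique.
  This gives the gradient the compact support that averaging over segments requires.\<close>

lemma gradient_eq_0_off_support:
  fixes g :: "'a::real_inner \<Rightarrow> real"
  assumes "\<And>x. (g has_derivative (\<lambda>h. g' x \<bullet> h)) (at x)" and "x \<notin> closure {x. g x \<noteq> 0}"
  shows "g' x = 0"
proof -
  have "(g has_derivative (\<lambda>h. 0)) (at x)"
    by (rule has_derivative_transform_within_open[where f = "\<lambda>_. 0" and s = "- closure {x. g x \<noteq> 0}"])
      (use assms(2) closure_subset[of "{x. g x \<noteq> 0}"] in auto)
  then have "(\<lambda>h. g' x \<bullet> h) = (\<lambda>h. 0)" using assms(1) has_derivative_unique by blast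
  then have "g' x \<bullet> g' x = 0" by metis
  then show ?thesis by simp
qed

text \<open>On the reals \<open>SUP\<close> is an upper bound only for bounded families; this makes
  the sup norm meaningful.\<close>

lemma bdd_above_abs_compact_support:
  fixes g :: "'a::topological_space \<Rightarrow> real"
  assumes "continuous_on UNIV g" "compact K" "\<And>x. x \<notin> K \<Longrightarrow> g x = 0"
  shows "bdd_above (range (\<lambda>x. \<bar>g x\<bar>))"
proof -
  have "compact (g ` K)"
    by (rule compact_continuous_image[OF continuous_on_subset[OF assms(1)] assms(2)]) auto
  then obtain b where b: "\<And>x. x \<in> K \<Longrightarrow> \<bar>g x\<bar> \<le> b"
    using compact_imp_bounded[of "g ` K"] by (auto simp: bounded_iff)
  have "\<bar>g x\<bar> \<le> max b 0" for x using b[of x] assms(3)[of x] by (cases "x \<in> K") auto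
  then show ?thesis by (auto intro!: bdd_aboveI)
qed

lemma oscillatory_integral_bound:
  fixes g :: "real^'n::finite \<Rightarrow> real" and g' :: "real^'n \<Rightarrow> real^'n"
  assumes c: "mpoly_coeffs c" "mpoly_degree c = d" "d \<ge> 1"
    and v: "top_form c v \<noteq> 0" and "t > 0"
    and g: "\<And>x. (g has_derivative (\<lambda>h. g' x \<bullet> h)) (at x)" and g': "continuous_on UNIV g'"
    and supp: "closure {x. g x \<noteq> 0} \<subseteq> cball 0 R"
  shows "norm (\<integral>x. cis (t * mpoly_eval c x) * complex_of_real (g x) \<partial>lborel)
     \<le> 5 * 2 ^ d * (fact d * \<bar>top_form c v\<bar>) powr (- 1 / real d) * t powr (- 1 / real d)
       * (measure lborel (cball (0::real^'n) (R + norm v)) * (SUP x. \<bar>g x\<bar>)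
          + norm v * (\<integral>x. norm (g' x) \<partial>lborel))"
proof -
  define h where "h x = cis (t * mpoly_eval c x) * complex_of_real (g x)" for x
  define M where "M = 5 * 2 ^ d * (fact d * \<bar>top_form c v\<bar>) powr (- 1 / real d) * t powr (- 1 / real d)"
  define G where "G = (SUP x. \<bar>g x\<bar>)"
  define B where "B = cball (0::real^'n) (R + norm v)"
  define K where "K = cball (0::real^'n) R"
  define N where "N x = integral {0..1} (\<lambda>s. norm (g' (x + s *\<^sub>R v)))" for x
  have M0: "M \<ge> 0" by (simp add: M_def)
  have contg: "continuous_on UNIV g"
    by (intro continuous_at_imp_continuous_on ballI has_derivative_continuous[OF g])
  have g0: "g x = 0" if "x \<notin> K" for x
    using that supp closure_subset[of "{x. g x \<noteq> 0}"] unfolding K_def by blast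
  have g'0: "g' x = 0" if "x \<notin> K" for x
    using gradient_eq_0_off_support[OF g] that supp unfolding K_def by blast
  have conth: "continuous_on UNIV h"
    unfolding h_def by (intro continuous_intros contg continuous_on_mpoly_eval)
  have h0: "h x = 0" if "x \<notin> K" for x using g0[OF that] by (simp add: h_def)
  have "compact K" by (simp add: K_def)
  have contn: "continuous_on UNIV (\<lambda>x. norm (g' x))" by (intro continuous_intros g')
  have avh: "integrable lborel (\<lambda>x. integral {0..1} (\<lambda>s. h (x + s *\<^sub>R v)))"
    "(\<integral>x. integral {0..1} (\<lambda>s. h (x + s *\<^sub>R v)) \<partial>lborel) = (\<integral>x. h x \<partial>lborel)"
    by (rule lborel_integral_segment_average[OF conth \<open>compact K\<close>], erule h0)+
  have n0: "norm (g' x) = 0" if "x \<notin> K" for x using g'0[OF that] by simp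
  have avn: "integrable lborel N" "(\<integral>x. N x \<partial>lborel) = (\<integral>x. norm (g' x) \<partial>lborel)"
    unfolding N_def by (rule lborel_integral_segment_average[OF contn \<open>compact K\<close>], erule n0)+
  have bdd: "bdd_above (range (\<lambda>x. \<bar>g x\<bar>))"
    using contg \<open>compact K\<close> g0 by (rule bdd_above_abs_compact_support)
  have gG: "\<bar>g x\<bar> \<le> G" for x unfolding G_def by (rule cSUP_upper[OF _ bdd]) auto
  have N0: "N x \<ge> 0" for x unfolding N_def by (intro integral_nonneg integrable_continuous_real
     continuous_on_compose2[OF contn] continuous_intros) auto
  have G0: "G \<ge> 0" using gG[of 0] by linarith
  have intB: "integrable lborel (\<lambda>x. indicator B x * G)"
    by (auto simp: B_def intro!: integrable_real_indicator emeasure_bounded_finite)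
  have intN: "integrable lborel (\<lambda>x. norm v * N x)"
    using avn(1) by simp
  have intr: "integrable lborel (\<lambda>x. M * (indicator B x * G + norm v * N x))"
    by (intro integrable_mult_right Bochner_Integration.integrable_add intB intN)
  \<comment> \<open>The constant \<open>G\<close> is integrable only over a set of finite measure,
    hence the indicator. For \<open>x\<close> outside \<open>B\<close> the whole segment from
    \<open>x\<close> to \<open>x + v\<close> misses \<open>K\<close>, so the left side is 0.\<close>
  have pt: "norm (integral {0..1} (\<lambda>s. h (x + s *\<^sub>R v))) \<le> M * (indicator B x * G + norm v * N x)" for x
  proof (cases "x \<in> B")
    case True
    have "norm (integral {0..1} (\<lambda>s. h (x + s *\<^sub>R v))) \<le> M * (\<bar>g (x + v)\<bar> + norm v * N x)"
      unfolding h_def M_def N_def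
      by (rule oscillatory_integral_segment_bound) (use assms in auto)
    also have "\<dots> \<le> M * (indicator B x * G + norm v * N x)"
      using True gG[of "x + v"] M0 by (intro mult_left_mono) auto
    finally show ?thesis .
  next
    case False
    have "h (x + s *\<^sub>R v) = 0" if "s \<in> {0..1}" for s
    proof -
      have "norm x \<le> norm (x + s *\<^sub>R v) + norm (s *\<^sub>R v)"
        using norm_triangle_ineq4[of "x + s *\<^sub>R v" "s *\<^sub>R v"] by simp
      moreover have "norm (s *\<^sub>R v) \<le> norm v" using that by (simp add: mult_left_le_one_le)
      ultimately have "x + s *\<^sub>R v \<notin> K" using False by (auto simp: B_def K_def)
      then show ?thesis by (rule h0)
    qed
    then have "integral {0..1} (\<lambda>s. h (x + s *\<^sub>R v)) = integral {0..1::real} (\<lambda>s. 0)"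
      by (rule Henstock_Kurzweil_Integration.integral_cong)
    then show ?thesis using M0 N0 G0 by simp
  qed
  have "norm (\<integral>x. h x \<partial>lborel) \<le> (\<integral>x. norm (integral {0..1} (\<lambda>s. h (x + s *\<^sub>R v))) \<partial>lborel)"
    unfolding avh(2)[symmetric] by (rule integral_norm_bound)
  also have "\<dots> \<le> (\<integral>x. M * (indicator B x * G + norm v * N x) \<partial>lborel)"
    by (intro integral_mono integrable_norm avh(1) intr pt)
  also have "\<dots> = M * (measure lborel B * G + norm v * (\<integral>x. norm (g' x) \<partial>lborel))"
    using Bochner_Integration.integral_add[OF intB intN] avn(2) by simp
  finally show ?thesis unfolding M_def G_def B_def h_def .
qed

theorem theorem2:
  fixes c :: "('n::finite \<Rightarrow> nat) \<Rightarrow> real" and f :: "real^'n \<Rightarrow> real"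
    and d :: nat and A :: "(real^'n) set"
  assumes "mpoly_coeffs c" and "f = mpoly_eval c" and "mpoly_degree c = d" and "d \<ge> 1"
    and "compact A" and "semialgebraic A"
  shows "\<exists>C>0. \<forall>(g :: real^'n \<Rightarrow> real) (g' :: real^'n \<Rightarrow> real^'n).
           (\<forall>x. (g has_derivative (\<lambda>h. g' x \<bullet> h)) (at x)) \<and> continuous_on UNIV g'
           \<and> compact (closure {x. g x \<noteq> 0}) \<and> closure {x. g x \<noteq> 0} \<subseteq> A \<longrightarrow>
           (\<forall>t::real. t > 0 \<longrightarrow>
              norm (integral A (\<lambda>x. cis (t * f x) * complex_of_real (g x)))
                \<le> C * t powr (- 1 / real d) *
                  ((SUP x. \<bar>g x\<bar>) + integral UNIV (\<lambda>x. norm (g' x))))"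
proof -
  obtain v where v: "top_form c v \<noteq> 0"
    using exists_top_form_nonzero[of c] assms by auto
  obtain R where R: "A \<subseteq> cball 0 R"
    using compact_imp_bounded[OF \<open>compact A\<close>] by (auto simp: bounded_iff subset_iff)
  define L where "L = 5 * 2 ^ d * (fact d * \<bar>top_form c v\<bar>) powr (- 1 / real d)"
  \<comment> \<open>\<open>V\<close> dominates both the volume factor of the sup norm and the factor
    \<open>norm v\<close> of the gradient term; the 1 ensures positivity. \<open>L\<close> and
    \<open>V\<close> are fixed before \<open>g\<close> and \<open>t\<close> are introduced.\<close>
  define V where "V = measure lborel (cball (0::real^'n) (R + norm v)) + norm v + 1"
  have "L > 0" using v by (simp add: L_def)
  have "V > 0" unfolding V_def by (smt (verit) measure_nonneg norm_ge_zero)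
  show ?thesis
  proof (intro exI[of _ "L * V"] conjI allI impI)
    show "L * V > 0" using \<open>L > 0\<close> \<open>V > 0\<close> by simp
  next
    fix g :: "real^'n \<Rightarrow> real" and g' :: "real^'n \<Rightarrow> real^'n" and t :: real
    assume H: "(\<forall>x. (g has_derivative (\<lambda>h. g' x \<bullet> h)) (at x)) \<and> continuous_on UNIV g'
           \<and> compact (closure {x. g x \<noteq> 0}) \<and> closure {x. g x \<noteq> 0} \<subseteq> A" and "t > 0"
    define h where "h x = cis (t * f x) * complex_of_real (g x)" for x
    define G where "G = (SUP x. \<bar>g x\<bar>)"
    define D where "D = (\<integral>x. norm (g' x) \<partial>lborel)"
    show "norm (integral A (\<lambda>x. cis (t * f x) * complex_of_real (g x)))
         \<le> L * V * t powr (- 1 / real d) * ((SUP x. \<bar>g x\<bar>) + integral UNIV (\<lambda>x. norm (g' x)))"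
    proof -
      have g0: "g x = 0" if "x \<notin> A" for x using that H closure_subset[of "{x. g x \<noteq> 0}"] by blast
      have supp: "closure {x. g x \<noteq> 0} \<subseteq> cball 0 R" using H R by blast
      have contg: "continuous_on UNIV g"
        by (intro continuous_at_imp_continuous_on ballI has_derivative_continuous) (use H in blast)
      have "integrable lborel h" unfolding h_def assms
        by (rule integrable_lborel_compact_support[OF _ \<open>compact A\<close>])
          (auto intro!: continuous_intros contg continuous_on_mpoly_eval simp: g0)
      \<comment> \<open>Since \<open>g\<close> vanishes off \<open>A\<close>, the gauge integral
        over \<open>A\<close> becomes the Lebesgue integral over the whole space, where translation
        invariance is available.\<close>
      have "integral A h = integral UNIV (\<lambda>x. if x \<in> A then h x else 0)"
        by (simp add: integral_restrict_UNIV)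
      also have "(\<lambda>x. if x \<in> A then h x else 0) = h" by (auto simp: h_def g0)
      finally have "integral A h = (\<integral>x. h x \<partial>lborel)"
        using integral_lborel[OF \<open>integrable lborel h\<close>] by simp
      then have "norm (integral A h) \<le> L * t powr (- 1 / real d)
          * (measure lborel (cball (0::real^'n) (R + norm v)) * G + norm v * D)"
        using oscillatory_integral_bound[OF assms(1,3,4) v \<open>t > 0\<close> _ _ supp] H
        unfolding h_def L_def G_def D_def assms(2) by auto
      also have "\<dots> \<le> L * t powr (- 1 / real d) * (V * G + V * D)"
      proof -
        have "G \<ge> 0"
          using cSUP_upper[OF UNIV_I bdd_above_abs_compact_support[OF contg \<open>compact A\<close> g0], of 0]
          unfolding G_def by linarith
        moreover have "D \<ge> 0" unfolding D_def by simp
        ultimately show ?thesis using \<open>L > 0\<close>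
          by (intro mult_left_mono add_mono mult_right_mono) (auto simp: V_def)
      qed
      also have "\<dots> = L * V * t powr (- 1 / real d) * (G + D)" by (simp add: algebra_simps)
      \<comment> \<open>Back to the gauge integral of the statement; both integrals agree because
        the gradient norm is continuous and vanishes off the compact set \<open>A\<close>.\<close>
      also have "D = integral UNIV (\<lambda>x. norm (g' x))"
        unfolding D_def
      proof (rule integral_lborel[symmetric], rule integrable_lborel_compact_support[OF _ \<open>compact A\<close>])
        show "continuous_on UNIV (\<lambda>x. norm (g' x))" using H by (intro continuous_intros) auto
        show "norm (g' x) = 0" if "x \<notin> A" for x
          using that H gradient_eq_0_off_support[of g g' x] by auto
      qed
      finally show ?thesis unfolding h_def G_def .
    qed
  qed
qed

end
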